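(* Let $l_0,l_1,l_2,l_3\in\mathbb Z_{\ge 0}$, $r_1,\dots,r_M\in\mathbb Z_{>0}$, and assume that all the regular singular points $z=b_{i'}$ ($i'=1,\dots,M$) of the Fuchsian equation (F) described in the context are apparent. Let $\Xi(x)$ be a non-zero even doubly-periodic solution of $$\left\{\frac{d^3}{dx^3}-4(v(x)-E)\frac{d}{dx}-2\frac{dv(x)}{dx}\right\}\Xi(x)=0$$ having an expansion $$\Xi (x)=c_0+\sum_{i=0}^3 \sum_{j=0}^{l_i-1} b^{(i)}_j \wp (x+\omega_i)^{l_i-j} + \sum _{i'=1}^M \sum_{j=0}^{r_{i'}-1} \frac{d^{(i')}_j}{(\wp (x)-\wp (\delta _{i'}))^{r_{i'} -j}},$$ and let $$Q= \Xi (x)^2\left( E- v(x)\right) +\frac{1}{2}\Xi (x)\frac{d^2\Xi (x)}{dx^2}-\frac{1}{4}\left(\frac{d\Xi (x)}{dx} \right)^2$$ (a quantity independent of $x$). Then the function $$\Lambda(x)=\sqrt{\Xi (x)}\exp \int \frac{ \sqrt{-Q}\,dx}{\Xi (x)}$$ is a solution of $-f''(x)+v(x)f(x)=Ef(x)$, and the function $$\Lambda_g(x)=\Psi_g(x)\sqrt{\Xi (x)}\exp \int \frac{ \sqrt{-Q}\,dx}{\Xi (x)}$$ is a solution of the equation (Hg) described in the context.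
   Context: Fix $\omega_1,\omega_3\in\mathbb C$ linearly independent over $\mathbb R$; put $\omega_0=0$, $\omega_2=-\omega_1-\omega_3$. Let $\wp$ be the Weierstrass function with periods $(2\omega_1,2\omega_3)$ and $e_i=\wp(\omega_i)$ ($i=1,2,3$). "Doubly-periodic" means meromorphic on $\mathbb C$ with periods $2\omega_1,2\omega_3$. Let $M\ge 0$ be an integer, $\delta_1,\dots,\delta_M\in\mathbb C$ with $b_{i'}=\wp(\delta_{i'})$ finite and $e_1,e_2,e_3,b_1,\dots,b_M$ pairwise distinct, and $s_1,\dots,s_M,E\in\mathbb C$. Set $$v(x)=\sum_{i=0}^3 l_i(l_i+1)\wp (x+\omega_i)+ \sum_{i'=1}^M \left\{\frac{r_{i'}}{2} \left( \frac{r_{i'}}{2}+1\right) (\wp (x-\delta _{i'}) + \wp (x+\delta _{i'})) +\frac{s_{i'}}{\wp (x) -\wp (\delta _{i'})}\right\}.$$ (F) is the Fuchsian equation for $\tilde f(z)$ obtained from $-f''+vf=Ef$ by $z=\wp(x)$, $f(x)=\tilde f(z)\Phi(z)$, $\Phi(z)=\prod_{i=1}^3(z-e_i)^{-l_i/2}\prod_{i'=1}^M(z-b_{i'})^{-r_{i'}/2}$; it has the form $$\tilde f''+\Big(\sum_{i=1}^3\frac{\frac12-l_i}{z-e_i}-\sum_{i'=1}^M\frac{r_{i'}}{z-b_{i'}}\Big)\tilde f'+\frac{N(N-2l_0-1)z+p+\sum_{i'}\frac{o_{i'}}{z-b_{i'}}}{4(z-e_1)(z-e_2)(z-e_3)}\tilde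 f=0,$$ with $N=\sum_{i=0}^3 l_i+\sum_{i'} r_{i'}$ and constants $p,o_{i'}$ determined by the data. Its exponents at $z=b_{i'}$ are $0$ and $r_{i'}+1$. A regular singular point is apparent if its exponents are integers and there is no logarithmic solution there (equivalently, the local monodromy matrix is the identity). $\Psi_g(x)=\prod_{i'=1}^M(\wp(x)-\wp(\delta_{i'}))^{r_{i'}/2}$. (Hg) is the equation satisfied by $f_g=\Psi_g f$ when $-f''+vf=Ef$; explicitly $f_g''-2\varphi f_g'+(\varphi^2-\varphi'-v+E)f_g=0$ with $\varphi=\Psi_g'/\Psi_g=\frac12\sum_{i'}r_{i'}\wp'(x)/(\wp(x)-\wp(\delta_{i'}))$. *)

theory Defs
  imports "HOL-Complex_Analysis.Complex_Analysis"
begin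

section \<open>The Weierstrass function\<close>

definition half_period :: "complex \<Rightarrow> complex \<Rightarrow> nat \<Rightarrow> complex" where
  "half_period \<omega>1 \<omega>3 i =
     (if i = 0 then 0 else if i = 1 then \<omega>1 else if i = 2 then - \<omega>1 - \<omega>3 else \<omega>3)"

definition period_lattice :: "complex \<Rightarrow> complex \<Rightarrow> complex set" where
  "period_lattice \<omega>1 \<omega>3 = {2 * of_int m * \<omega>1 + 2 * of_int n * \<omega>3 | m n. True}"

text \<open>
  The value of the following function at a lattice point (a pole) has no meaning.
\<close>
definition wp :: "complex \<Rightarrow> complex \<Rightarrow> complex \<Rightarrow> complex" where
  "wp \<omega>1 \<omega>3 x =
     1 / x ^ 2 + infsum (\<lambda>\<omega>. 1 / (x - \<omega>) ^ 2 - 1 / \<omega> ^ 2) (period_lattice \<omega>1 \<omega>3 - {0})"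

definition wp_e :: "complex \<Rightarrow> complex \<Rightarrow> nat \<Rightarrow> complex" where
  "wp_e \<omega>1 \<omega>3 i = wp \<omega>1 \<omega>3 (half_period \<omega>1 \<omega>3 i)"

text \<open>
  Meromorphic functions on the plane are represented by \<open>nicely_meromorphic_on\<close>: analytic away from
  the poles, with value 0 at the poles.
\<close>
definition doubly_periodic :: "complex \<Rightarrow> complex \<Rightarrow> (complex \<Rightarrow> complex) \<Rightarrow> bool" where
  "doubly_periodic \<omega>1 \<omega>3 f \<longleftrightarrow> f nicely_meromorphic_on UNIV \<and>
     (\<forall>x. f (x + 2 * \<omega>1) = f x) \<and> (\<forall>x. f (x + 2 * \<omega>3) = f x)"

section \<open>The potential and the Schroedinger equation\<close>

text \<open>
  \<open>remove_sings\<close> turns the formula into a meromorphic function: at a half-period with \<open>l i = 0\<close>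
  the terms of the formula may be undefined although the potential is regular there.
\<close>
definition potential ::
  "complex \<Rightarrow> complex \<Rightarrow> (nat \<Rightarrow> nat) \<Rightarrow> nat \<Rightarrow> (nat \<Rightarrow> complex) \<Rightarrow> (nat \<Rightarrow> nat) \<Rightarrow> (nat \<Rightarrow> complex)
     \<Rightarrow> complex \<Rightarrow> complex" where
  "potential \<omega>1 \<omega>3 l M \<delta> r s = remove_sings (\<lambda>x.
     (\<Sum>i\<in>{0..3}. of_nat (l i) * (of_nat (l i) + 1) * wp \<omega>1 \<omega>3 (x + half_period \<omega>1 \<omega>3 i)) +
     (\<Sum>k\<in>{1..M}. of_nat (r k) / 2 * (of_nat (r k) / 2 + 1)
                       * (wp \<omega>1 \<omega>3 (x - \<delta> k) + wp \<omega>1 \<omega>3 (x + \<delta> k))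
                    + s k / (wp \<omega>1 \<omega>3 x - wp \<omega>1 \<omega>3 (\<delta> k))))"

definition schroedinger_at :: "(complex \<Rightarrow> complex) \<Rightarrow> complex \<Rightarrow> (complex \<Rightarrow> complex) \<Rightarrow> complex \<Rightarrow> bool" where
  "schroedinger_at v E f x \<longleftrightarrow> - (deriv ^^ 2) f x + v x * f x = E * f x"

definition schroedinger_solution ::
  "(complex \<Rightarrow> complex) \<Rightarrow> complex \<Rightarrow> complex set \<Rightarrow> (complex \<Rightarrow> complex) \<Rightarrow> bool" where
  "schroedinger_solution v E U f \<longleftrightarrow> f holomorphic_on U \<and> (\<forall>x\<in>U. schroedinger_at v E f x)"

section \<open>Equations of second order in the complex domain\<close>

text \<open>
  A pair \<open>P\<close>, \<open>R\<close> of coefficient functions stands for the equation \<open>y'' + P y' + R y = 0\<close>.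
\<close>
definition ode2_at ::
  "(complex \<Rightarrow> complex) \<Rightarrow> (complex \<Rightarrow> complex) \<Rightarrow> (complex \<Rightarrow> complex) \<Rightarrow> complex \<Rightarrow> bool" where
  "ode2_at P R y z \<longleftrightarrow> (deriv ^^ 2) y z + P z * deriv y z + R z * y z = 0"

definition regular_singular_point ::
  "(complex \<Rightarrow> complex) \<Rightarrow> (complex \<Rightarrow> complex) \<Rightarrow> complex \<Rightarrow> bool" where
  "regular_singular_point P R a \<longleftrightarrow>
     P meromorphic_on {a} \<and> R meromorphic_on {a} \<and> (is_pole P a \<or> is_pole R a) \<and>
     \<not> is_pole (\<lambda>z. (z - a) * P z) a \<and> \<not> is_pole (\<lambda>z. (z - a) ^ 2 * R z) a"

definition exponents ::
  "(complex \<Rightarrow> complex) \<Rightarrow> (complex \<Rightarrow> complex) \<Rightarrow> complex \<Rightarrow> complex set" where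
  "exponents P R a =
     {\<rho>. \<rho> * (\<rho> - 1) + Lim (at a) (\<lambda>z. (z - a) * P z) * \<rho> + Lim (at a) (\<lambda>z. (z - a) ^ 2 * R z) = 0}"

text \<open>
  When the exponents are integers, every local solution has the form \<open>g + h log (z - a)\<close> with \<open>g\<close>
  and \<open>h\<close> holomorphic near \<open>a\<close> up to a possible pole at \<open>a\<close>; it is logarithmic if \<open>h\<close> does not
  vanish identically.  The choice of the slit is immaterial: another branch of the logarithm
  changes \<open>g\<close> by a constant multiple of \<open>h\<close>.
\<close>
definition has_logarithmic_solution ::
  "(complex \<Rightarrow> complex) \<Rightarrow> (complex \<Rightarrow> complex) \<Rightarrow> complex \<Rightarrow> bool" where
  "has_logarithmic_solution P R a \<longleftrightarrow> (\<exists>\<epsilon>>0. \<exists>g h.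
     g meromorphic_on {a} \<and> g holomorphic_on ball a \<epsilon> - {a} \<and>
     h meromorphic_on {a} \<and> h holomorphic_on ball a \<epsilon> - {a} \<and>
     (\<exists>z\<in>ball a \<epsilon> - {a}. h z \<noteq> 0) \<and>
     (\<forall>z\<in>ball a \<epsilon>. z - a \<notin> \<real>\<^sub>\<le>\<^sub>0 \<longrightarrow> ode2_at P R (\<lambda>w. g w + h w * Ln (w - a)) z))"

definition apparent_singularity ::
  "(complex \<Rightarrow> complex) \<Rightarrow> (complex \<Rightarrow> complex) \<Rightarrow> complex \<Rightarrow> bool" where
  "apparent_singularity P R a \<longleftrightarrow>
     regular_singular_point P R a \<and> exponents P R a \<subseteq> \<int> \<and> \<not> has_logarithmic_solution P R a"

section \<open>The Fuchsian equation\<close>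

definition fuchsian_P ::
  "complex \<Rightarrow> complex \<Rightarrow> (nat \<Rightarrow> nat) \<Rightarrow> nat \<Rightarrow> (nat \<Rightarrow> complex) \<Rightarrow> (nat \<Rightarrow> nat) \<Rightarrow> complex \<Rightarrow> complex" where
  "fuchsian_P \<omega>1 \<omega>3 l M \<delta> r z =
     (\<Sum>i\<in>{1..3}. (1 / 2 - of_nat (l i)) / (z - wp_e \<omega>1 \<omega>3 i))
     - (\<Sum>k\<in>{1..M}. of_nat (r k) / (z - wp \<omega>1 \<omega>3 (\<delta> k)))"

definition fuchsian_R ::
  "complex \<Rightarrow> complex \<Rightarrow> (nat \<Rightarrow> nat) \<Rightarrow> nat \<Rightarrow> (nat \<Rightarrow> complex) \<Rightarrow> (nat \<Rightarrow> nat) \<Rightarrow>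
     complex \<Rightarrow> (nat \<Rightarrow> complex) \<Rightarrow> complex \<Rightarrow> complex" where
  "fuchsian_R \<omega>1 \<omega>3 l M \<delta> r p oc z =
     (let N = of_nat ((\<Sum>i\<in>{0..3}. l i) + (\<Sum>k\<in>{1..M}. r k)) in
      (N * (N - 2 * of_nat (l 0) - 1) * z + p + (\<Sum>k\<in>{1..M}. oc k / (z - wp \<omega>1 \<omega>3 (\<delta> k))))
      / (4 * (z - wp_e \<omega>1 \<omega>3 1) * (z - wp_e \<omega>1 \<omega>3 2) * (z - wp_e \<omega>1 \<omega>3 3)))"

definition sqrt_branch :: "complex set \<Rightarrow> (complex \<Rightarrow> complex) \<Rightarrow> (complex \<Rightarrow> complex) \<Rightarrow> bool" where
  "sqrt_branch U f g \<longleftrightarrow> g holomorphic_on U \<and> (\<forall>x\<in>U. g x ^ 2 = f x)"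

text \<open>
  The constants \<open>p\<close> and \<open>oc k\<close> are those for which the substitution \<open>z = wp x\<close>,
  \<open>f x = ft z * \<Phi> z\<close> turns the Schroedinger equation for \<open>f\<close> into the Fuchsian equation for \<open>ft\<close>.
  Here \<open>\<Phi>\<close> is any branch, on an open set \<open>W\<close> of regular points, of the product of the powers
  \<open>(z - e i) powr (- l i / 2)\<close> and \<open>(z - b k) powr (- r k / 2)\<close>, given by branches \<open>A i\<close>, \<open>B k\<close> of
  the square roots of \<open>z - e i\<close> and \<open>z - b k\<close>.  As \<open>ft\<close> is arbitrary (so that its 2-jet at a point
  is), this determines \<open>p\<close> and \<open>oc k\<close> uniquely.
\<close>
definition fuchsian_constants ::
  "complex \<Rightarrow> complex \<Rightarrow> (nat \<Rightarrow> nat) \<Rightarrow> nat \<Rightarrow> (nat \<Rightarrow> complex) \<Rightarrow> (nat \<Rightarrow> nat) \<Rightarrow> (nat \<Rightarrow> complex) \<Rightarrow>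
     complex \<Rightarrow> complex \<Rightarrow> (nat \<Rightarrow> complex) \<Rightarrow> bool" where
  "fuchsian_constants \<omega>1 \<omega>3 l M \<delta> r s E p oc \<longleftrightarrow>
     (\<forall>W A B ft.
        open W \<and>
        W \<inter> (wp_e \<omega>1 \<omega>3 ` {1..3} \<union> (\<lambda>k. wp \<omega>1 \<omega>3 (\<delta> k)) ` {1..M}) = {} \<and>
        (\<forall>i\<in>{1..3}. sqrt_branch W (\<lambda>z. z - wp_e \<omega>1 \<omega>3 i) (A i)) \<and>
        (\<forall>k\<in>{1..M}. sqrt_branch W (\<lambda>z. z - wp \<omega>1 \<omega>3 (\<delta> k)) (B k)) \<and>
        ft holomorphic_on W \<longrightarrow>
        (let \<Phi> = (\<lambda>z. 1 / ((\<Prod>i\<in>{1..3}. A i z ^ l i) * (\<Prod>k\<in>{1..M}. B k z ^ r k))) in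
         \<forall>x. x \<notin> period_lattice \<omega>1 \<omega>3 \<and> wp \<omega>1 \<omega>3 x \<in> W \<longrightarrow>
           (schroedinger_at (potential \<omega>1 \<omega>3 l M \<delta> r s) E
              (\<lambda>y. ft (wp \<omega>1 \<omega>3 y) * \<Phi> (wp \<omega>1 \<omega>3 y)) x
            \<longleftrightarrow>
            ode2_at (fuchsian_P \<omega>1 \<omega>3 l M \<delta> r) (fuchsian_R \<omega>1 \<omega>3 l M \<delta> r p oc) ft (wp \<omega>1 \<omega>3 x))))"

section \<open>The equation for \<open>f\<^sub>g\<close>\<close>

definition gauge_phi ::
  "complex \<Rightarrow> complex \<Rightarrow> nat \<Rightarrow> (nat \<Rightarrow> complex) \<Rightarrow> (nat \<Rightarrow> nat) \<Rightarrow> complex \<Rightarrow> complex" where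
  "gauge_phi \<omega>1 \<omega>3 M \<delta> r x =
     1 / 2 * (\<Sum>k\<in>{1..M}. of_nat (r k) * deriv (wp \<omega>1 \<omega>3) x / (wp \<omega>1 \<omega>3 x - wp \<omega>1 \<omega>3 (\<delta> k)))"

definition gauged_solution ::
  "(complex \<Rightarrow> complex) \<Rightarrow> (complex \<Rightarrow> complex) \<Rightarrow> complex \<Rightarrow> complex set \<Rightarrow> (complex \<Rightarrow> complex) \<Rightarrow> bool" where
  "gauged_solution \<phi> v E U f \<longleftrightarrow> f holomorphic_on U \<and>
     (\<forall>x\<in>U. (deriv ^^ 2) f x - 2 * \<phi> x * deriv f x
               + (\<phi> x ^ 2 - deriv \<phi> x - v x + E) * f x = 0)"

text \<open>A branch of \<open>\<Psi>\<^sub>g\<close>, the product of the powers \<open>(wp x - wp (\<delta> k)) powr (r k / 2)\<close>.\<close>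
definition Psi_g_branch ::
  "complex \<Rightarrow> complex \<Rightarrow> nat \<Rightarrow> (nat \<Rightarrow> complex) \<Rightarrow> (nat \<Rightarrow> nat) \<Rightarrow> complex set \<Rightarrow> (complex \<Rightarrow> complex) \<Rightarrow> bool" where
  "Psi_g_branch \<omega>1 \<omega>3 M \<delta> r U \<Psi> \<longleftrightarrow>
     (\<exists>G. (\<forall>k\<in>{1..M}. sqrt_branch U (\<lambda>x. wp \<omega>1 \<omega>3 x - wp \<omega>1 \<omega>3 (\<delta> k)) (G k)) \<and>
          (\<forall>x\<in>U. \<Psi> x = (\<Prod>k\<in>{1..M}. G k x ^ r k)))"

section \<open>The functions built from \<open>\<Xi>\<close>\<close>

definition Xi_quantity ::
  "(complex \<Rightarrow> complex) \<Rightarrow> complex \<Rightarrow> (complex \<Rightarrow> complex) \<Rightarrow> complex \<Rightarrow> complex" where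
  "Xi_quantity v E \<Xi> x =
     \<Xi> x ^ 2 * (E - v x) + 1 / 2 * \<Xi> x * (deriv ^^ 2) \<Xi> x - 1 / 4 * deriv \<Xi> x ^ 2"

text \<open>
  A branch on \<open>U\<close> of \<open>sqrt \<Xi> exp (\<integral> sqrt (- Q) / \<Xi> dx)\<close>: any choice \<open>S\<close> of the square root of
  \<open>\<Xi>\<close>, \<open>\<kappa>\<close> of the square root of the constant \<open>- Q\<close>, and \<open>J\<close> of the indefinite integral.
\<close>
definition Lambda_branch ::
  "(complex \<Rightarrow> complex) \<Rightarrow> complex \<Rightarrow> complex set \<Rightarrow> (complex \<Rightarrow> complex) \<Rightarrow> bool" where
  "Lambda_branch \<Xi> Q U \<Lambda> \<longleftrightarrow>
     (\<exists>S \<kappa> J. sqrt_branch U \<Xi> S \<and> \<kappa> ^ 2 = - Q \<and>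
        (\<forall>x\<in>U. (J has_field_derivative \<kappa> / \<Xi> x) (at x)) \<and>
        (\<forall>x\<in>U. \<Lambda> x = S x * exp (J x)))"

end

theory Submission
  imports Defs
begin

text \<open>
  The derivative of the quantity \<open>Q\<close> is \<open>\<Xi> / 2\<close> times the left-hand side of the third-order equation, so
  \<open>Q\<close> is locally constant.  To compare its values globally one needs the common domain of analyticity
  of \<open>v\<close> and \<open>\<Xi>\<close> to be connected: both functions are meromorphic, so only a sparse set is removed
  from the plane.  Meromorphy of \<open>wp\<close> rests on the convergence of the sum of \<open>1 / |\<omega>| ^ 3\<close> over the
  lattice, where \<open>|\<omega>| ^ 3\<close> is bounded below by a multiple of \<open>((1 + |m|) (1 + |n|)) powr (3 / 2)\<close>,
  which splits the double series into a product.

  Given \<open>Q\<close>, the logarithmic derivative of \<open>\<Lambda>\<close> is \<open>(\<Xi>' / 2 + \<kappa>) / \<Xi>\<close>, whence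
  \<open>\<Lambda>'' / \<Lambda> = \<Xi>'' / (2 \<Xi>) + (\<kappa>^2 - \<Xi>'^2 / 4) / \<Xi>^2 = v - E\<close> by \<open>\<kappa>^2 = - Q\<close>.
  The gauged equation follows from \<open>\<Psi>' = \<phi> \<Psi>\<close>.
\<close>

section \<open>Meromorphy of the Weierstrass function\<close>

text \<open>The integers are covered by the non-negative and the non-positive ones; on each half
  this is the series of \<open>n powr (-(3/2))\<close>, which converges as 3/2 > 1. The overlap at 0
  does no harm to summability.\<close>

lemma summable_on_int_powr:
  "(\<lambda>n::int. (1 + \<bar>real_of_int n\<bar>) powr (-(3/2))) summable_on UNIV"
proof -
  let ?f = "\<lambda>n::int. (1 + \<bar>real_of_int n\<bar>) powr (-(3/2))"
  have "summable (\<lambda>n. real (Suc n) powr (-(3/2)))"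
    by (subst summable_Suc_iff) (simp add: summable_real_powr_iff)
  hence *: "(\<lambda>n. real (Suc n) powr (-(3/2))) summable_on UNIV"
    by (subst summable_on_UNIV_nonneg_real_iff) auto
  have "?f summable_on range int"
    by (subst summable_on_reindex) (use * in \<open>auto simp: o_def\<close>)
  moreover have "?f summable_on range (\<lambda>n. - int n)"
    by (subst summable_on_reindex) (use * in \<open>auto simp: o_def inj_on_def\<close>)
  ultimately have "?f summable_on range int \<union> range (\<lambda>n. - int n)"
    by (rule summable_on_union)
  moreover have "range int \<union> range (\<lambda>n. - int n) = UNIV"
    using int_cases2 by blast
  ultimately show ?thesis
    by simp
qed

text \<open>Each inner sum is \<open>?f m\<close> times one fixed constant, so the outer sum reduces
  to the one-dimensional case.\<close>

lemma summable_on_int_prod_powr: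
  "(\<lambda>(m::int, n::int). ((1 + \<bar>real_of_int m\<bar>) * (1 + \<bar>real_of_int n\<bar>)) powr (-(3/2)))
     summable_on UNIV"
proof -
  let ?f = "\<lambda>n::int. (1 + \<bar>real_of_int n\<bar>) powr (-(3/2))"
  have "(\<lambda>(m, n). ?f m * ?f n) summable_on (Sigma UNIV (\<lambda>_. UNIV))"
  proof (rule summable_on_SigmaI)
    show "((\<lambda>n. case (m, n) of (m, n) \<Rightarrow> ?f m * ?f n) has_sum ?f m * infsum ?f UNIV) UNIV" for m
      using summable_on_int_powr by (auto intro!: has_sum_cmult_right has_sum_infsum)
    show "(\<lambda>m. ?f m * infsum ?f UNIV) summable_on UNIV"
      using summable_on_int_powr by (rule summable_on_cmult_left)
  qed auto
  thus ?thesis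
    by (simp add: powr_mult case_prod_unfold)
qed

text \<open>Linear independence over the reals makes the map from real coordinates to the plane
  injective, and an injective linear map between finite-dimensional spaces is bounded below.\<close>

lemma period_lattice_lower_bound:
  fixes \<omega>1 \<omega>3 :: complex
  assumes "\<omega>1 \<noteq> \<omega>3" "independent {\<omega>1, \<omega>3}"
  obtains B where "B > 0"
    "\<And>m n. B * norm (real_of_int m, real_of_int n) \<le> norm (2 * of_int m * \<omega>1 + 2 * of_int n * \<omega>3)"
proof -
  let ?h = "\<lambda>x::real \<times> real. (2 * fst x) *\<^sub>R \<omega>1 + (2 * snd x) *\<^sub>R \<omega>3"
  have lin: "linear ?h"
    by (rule linearI) (auto simp: algebra_simps)
  have "a = 0 \<and> b = 0" if "a *\<^sub>R \<omega>1 + b *\<^sub>R \<omega>3 = 0" for a b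
  proof -
    \<comment> \<open>The coefficients as a function on the basis; because
      \<open>\<omega>1 \<noteq> \<omega>3\<close>, it takes the value \<open>b\<close> at
      \<open>\<omega>3\<close>.\<close>
    let ?u = "\<lambda>x. if x = \<omega>1 then a else b"
    have sum: "(\<Sum>x\<in>{\<omega>1, \<omega>3}. ?u x *\<^sub>R x) = 0"
      using assms(1) that by simp
    have "?u x = 0" if "x \<in> {\<omega>1, \<omega>3}" for x
      by (rule independentD[OF assms(2) _ _ sum that]) auto
    hence "?u \<omega>1 = 0 \<and> ?u \<omega>3 = 0"
      by blast
    thus ?thesis
      using assms(1) by auto
  qed
  note zero = this
  have "x = 0" if "?h x = 0" for x
    using zero[OF that] by (simp add: prod_eq_iff)
  hence "inj ?h"
    unfolding linear_injective_0[OF lin] by blast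
  then obtain B where "B > 0" "\<And>x. B * norm x \<le> norm (?h x)"
    using linear_inj_bounded_below_pos[OF lin] by metis
  from this(1) this(2)[of "(real_of_int m, real_of_int n)" for m n] show ?thesis
    by (intro that) (auto simp: scaleR_conv_of_real)
qed

text \<open>By the lower bound, the integer coordinates of such points lie in the box of half-width
  \<open>K / B\<close>.\<close>

lemma finite_period_lattice_bounded:
  assumes "\<omega>1 \<noteq> \<omega>3" "independent {\<omega>1, \<omega>3}"
  shows "finite {\<omega> \<in> period_lattice \<omega>1 \<omega>3. norm \<omega> < K}"
proof -
  obtain B where B: "B > 0"
    "\<And>m n. B * norm (real_of_int m, real_of_int n) \<le> norm (2 * of_int m * \<omega>1 + 2 * of_int n * \<omega>3)"
    using period_lattice_lower_bound[OF assms] by blast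
  define N where "N = \<lceil>K / B\<rceil>"
  have "{\<omega> \<in> period_lattice \<omega>1 \<omega>3. norm \<omega> < K} \<subseteq>
      (\<lambda>(m, n). 2 * of_int m * \<omega>1 + 2 * of_int n * \<omega>3) ` ({-N..N} \<times> {-N..N})"
  proof
    fix \<omega> assume "\<omega> \<in> {\<omega> \<in> period_lattice \<omega>1 \<omega>3. norm \<omega> < K}"
    then obtain m n where \<omega>: "\<omega> = 2 * of_int m * \<omega>1 + 2 * of_int n * \<omega>3" "norm \<omega> < K"
      by (auto simp: period_lattice_def)
    have "B * norm (real_of_int m, real_of_int n) \<le> K"
      using B(2)[of m n] \<omega> by simp
    hence "norm (real_of_int m, real_of_int n) \<le> K / B"
      using B(1) by (simp add: field_simps)
    moreover have "\<bar>real_of_int m\<bar> \<le> norm (real_of_int m, real_of_int n)"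
      "\<bar>real_of_int n\<bar> \<le> norm (real_of_int m, real_of_int n)"
      using norm_fst_le[of "real_of_int m" "real_of_int n"]
        norm_snd_le[of "real_of_int n" "real_of_int m"] by auto
    moreover have "K / B \<le> real_of_int N"
      by (simp add: N_def)
    ultimately have "m \<in> {-N..N}" "n \<in> {-N..N}"
      by auto
    thus "\<omega> \<in> (\<lambda>(m, n). 2 * of_int m * \<omega>1 + 2 * of_int n * \<omega>3) ` ({-N..N} \<times> {-N..N})"
      using \<omega>(1) by force
  qed
  thus ?thesis
    by (rule finite_subset) simp
qed

text \<open>With \<open>N\<close> the Euclidean norm of the coordinate pair, |\<omega>| is at least
  \<open>B * N\<close>, while the product \<open>?p\<close> is at most \<open>(2 * N) ^ 2\<close>;
  comparing both with \<open>N ^ 3\<close> reduces the claim to the product series.\<close>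

lemma summable_on_period_lattice:
  assumes "\<omega>1 \<noteq> \<omega>3" "independent {\<omega>1, \<omega>3}"
  shows "(\<lambda>\<omega>. 1 / norm \<omega> ^ 3) summable_on period_lattice \<omega>1 \<omega>3 - {0}"
proof -
  obtain B where B: "B > 0"
    "\<And>m n. B * norm (real_of_int m, real_of_int n) \<le> norm (2 * of_int m * \<omega>1 + 2 * of_int n * \<omega>3)"
    using period_lattice_lower_bound[OF assms] by blast
  let ?h = "\<lambda>(m, n). 2 * of_int m * \<omega>1 + 2 * of_int n * \<omega>3"
  let ?p = "\<lambda>(m, n). (1 + \<bar>real_of_int m\<bar>) * (1 + \<bar>real_of_int n\<bar>)"
  have L: "period_lattice \<omega>1 \<omega>3 = range ?h"
    by (auto simp: period_lattice_def)
  \<comment> \<open>Injectivity, read off from the lower bound, allows the lattice sum to be indexed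
    by integer pairs.\<close>
  have inj: "inj ?h"
  proof (rule injI)
    fix a b :: "int \<times> int"
    assume eq: "?h a = ?h b"
    have "?h (fst a - fst b, snd a - snd b) = 0"
      using eq by (auto simp: case_prod_unfold algebra_simps)
    hence "B * norm (real_of_int (fst a - fst b), real_of_int (snd a - snd b)) \<le> 0"
      using B(2)[of "fst a - fst b" "snd a - snd b"] by simp
    hence "norm (real_of_int (fst a - fst b), real_of_int (snd a - snd b)) \<le> 0"
      using B(1) by (simp add: mult_le_0_iff)
    hence "real_of_int (fst a - fst b) = 0 \<and> real_of_int (snd a - snd b) = 0"
      by (simp only: norm_le_zero_iff zero_prod_def prod.inject)
    thus "a = b"
      by (auto simp: prod_eq_iff)
  qed
  have L0: "period_lattice \<omega>1 \<omega>3 - {0} = ?h ` (- {(0, 0)})"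
    unfolding L using image_set_diff[OF inj, of UNIV "{(0, 0)}"] by (simp add: Compl_eq_Diff_UNIV)
  have "(\<lambda>a. 1 / norm (?h a) ^ 3) summable_on - {(0, 0)}"
  proof (rule summable_on_comparison_test)
    have "(\<lambda>a. ?p a powr (-(3/2))) summable_on - {(0, 0)}"
      using summable_on_subset[OF summable_on_int_prod_powr subset_UNIV]
      by (simp add: case_prod_unfold)
    \<comment> \<open>The 8 comes from \<open>(2 * N) ^ 3\<close>, the \<open>B ^ 3\<close> from the
      lower bound on lattice points.\<close>
    thus "(\<lambda>a. 8 / B ^ 3 * ?p a powr (-(3/2))) summable_on - {(0, 0)}"
      by (rule summable_on_cmult_right)
  next
    fix a :: "int \<times> int" assume a: "a \<in> - {(0, 0)}"
    obtain m n where mn: "a = (m, n)"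
      by force
    define N where "N = norm (real_of_int m, real_of_int n)"
    have le: "\<bar>real_of_int m\<bar> \<le> N" "\<bar>real_of_int n\<bar> \<le> N"
      using norm_fst_le[of "real_of_int m" "real_of_int n"]
        norm_snd_le[of "real_of_int n" "real_of_int m"] by (auto simp: N_def)
    have "\<bar>real_of_int m\<bar> \<ge> 1 \<or> \<bar>real_of_int n\<bar> \<ge> 1"
      using a by (auto simp: mn)
    hence N1: "N \<ge> 1"
      using le by linarith
    \<comment> \<open>Each factor is at most \<open>1 + N\<close>, hence at most
      \<open>2 * N\<close> since \<open>N \<ge> 1\<close>; this is where the origin has to be
      excluded.\<close>
    have P: "?p a \<le> (2 * N) ^ 2" "?p a > 0"
    proof -
      have "?p a \<le> (2 * N) * (2 * N)"
        unfolding mn prod.case by (rule mult_mono) (use le N1 in auto)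
      thus "?p a \<le> (2 * N) ^ 2"
        by (simp add: power2_eq_square)
      show "?p a > 0"
        unfolding mn by (auto intro!: mult_pos_pos add_pos_nonneg)
    qed
    have "?p a powr (3/2) \<le> ((2 * N) ^ 2) powr (3/2)"
      using P by (intro powr_mono2) auto
    also have "\<dots> = (2 * N) powr 3"
      using N1 powr_powr[of "2 * N" 2 "3/2"] by simp
    also have "\<dots> = 8 * N ^ 3"
      using N1 by (simp add: power_mult_distrib)
    finally have pow: "?p a powr (3/2) \<le> 8 * N ^ 3" .
    have pN: "8 / (8 * N ^ 3) \<le> 8 / ?p a powr (3/2)"
      by (rule frac_le[OF _ order_refl _ pow]) (use P in auto)
    have "B * N \<le> norm (?h a)"
      unfolding mn N_def using B(2) by simp
    hence cube: "(B * N) ^ 3 \<le> norm (?h a) ^ 3"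
      using B(1) N1 by (intro power_mono) auto
    have "1 / norm (?h a) ^ 3 \<le> 1 / (B * N) ^ 3"
      by (rule frac_le[OF _ order_refl _ cube]) (use B(1) N1 in auto)
    also have "\<dots> = 1 / B ^ 3 * (8 / (8 * N ^ 3))"
      by (simp add: power_mult_distrib)
    also have "\<dots> \<le> 1 / B ^ 3 * (8 / ?p a powr (3/2))"
      using pN B(1) by (intro mult_left_mono) auto
    also have "\<dots> = 8 / B ^ 3 * ?p a powr (-(3/2))"
      unfolding powr_minus by (simp only: divide_inverse mult_ac mult_1_left)
    finally show "1 / norm (?h a) ^ 3 \<le> 8 / B ^ 3 * ?p a powr (-(3/2))" .
  qed auto
  thus ?thesis
    unfolding L0 by (subst summable_on_reindex) (use inj in \<open>auto simp: o_def inj_on_def\<close>)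
qed

section \<open>Splitting \<open>wp\<close> on a disc into finitely many rational terms and a
  holomorphic tail\<close>

text \<open>Over a common denominator the leading terms cancel and the numerator is
  \<open>x * (2 * \<omega> - x)\<close>, of order |\<omega>| only. The constant 10 is 5/2 from
  |2\<omega> - x| times 4 from |x - \<omega>| being at least half of |\<omega>|.\<close>

lemma wp_summand_bound:
  fixes x \<omega> :: complex
  assumes "norm x \<le> R" "2 * R \<le> norm \<omega>" "R > 0"
  shows "norm (1 / (x - \<omega>) ^ 2 - 1 / \<omega> ^ 2) \<le> 10 * R * (1 / norm \<omega> ^ 3)"
proof -
  define W where "W = norm \<omega>"
  have W: "W > 0" "norm x \<le> W / 2" "R \<le> W / 2"
    using assms by (auto simp: W_def)
  have d: "norm (x - \<omega>) \<ge> W / 2"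
    using norm_triangle_ineq2[of \<omega> x] W unfolding W_def norm_minus_commute[of x] by linarith
  have nz: "\<omega> \<noteq> 0" "x \<noteq> \<omega>"
    using W d by (auto simp: W_def)
  have "1 / (x - \<omega>) ^ 2 - 1 / \<omega> ^ 2 = x * (2 * \<omega> - x) / ((x - \<omega>) ^ 2 * \<omega> ^ 2)"
    using nz by (simp add: divide_simps) (simp add: power2_eq_square algebra_simps)
  hence "norm (1 / (x - \<omega>) ^ 2 - 1 / \<omega> ^ 2) =
      norm x * norm (2 * \<omega> - x) / (norm (x - \<omega>) ^ 2 * W ^ 2)"
    by (simp add: norm_mult norm_divide norm_power W_def)
  also have "\<dots> \<le> R * (5 / 2 * W) / ((W / 2) ^ 2 * W ^ 2)"
  proof (rule frac_le)
    have "norm (2 * \<omega> - x) \<le> norm (2 * \<omega>) + norm x"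
      by (rule norm_triangle_ineq4)
    hence "norm (2 * \<omega> - x) \<le> 5 / 2 * W"
      using W by (simp add: norm_mult W_def)
    thus "norm x * norm (2 * \<omega> - x) \<le> R * (5 / 2 * W)"
      using assms by (intro mult_mono) auto
    show "(W / 2) ^ 2 * W ^ 2 \<le> norm (x - \<omega>) ^ 2 * W ^ 2"
      using d W by (intro mult_right_mono power_mono) auto
  qed (use W assms in auto)
  also have "\<dots> = 10 * R * (1 / W ^ 3)"
    using W by (simp add: field_simps power2_eq_square power3_eq_cube)
  finally show ?thesis
    by (simp add: W_def)
qed

text \<open>On a disc about 0, finitely many lattice points contribute rational functions; the sum
  over the others converges uniformly by the M-test and is holomorphic inside.\<close>

lemma wp_meromorphic:
  assumes "\<omega>1 \<noteq> \<omega>3" "independent {\<omega>1, \<omega>3}"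
  shows "wp \<omega>1 \<omega>3 meromorphic_on A"
proof -
  have "wp \<omega>1 \<omega>3 meromorphic_on {z}" for z
  proof -
    define R where "R = norm z + 1"
    have R: "R > 0" "z \<in> ball 0 R"
      by (auto simp: R_def add_nonneg_pos)
    define L where "L = period_lattice \<omega>1 \<omega>3 - {0}"
    \<comment> \<open>The threshold \<open>2 * R\<close> both keeps the poles of the remaining terms
      off the closed disc and meets the hypothesis of \<open>wp_summand_bound\<close>.\<close>
    define F where "F = {\<omega> \<in> L. norm \<omega> < 2 * R}"
    define g where "g = (\<lambda>x \<omega>::complex. 1 / (x - \<omega>) ^ 2 - 1 / \<omega> ^ 2)"
    have fin: "finite F"
      by (rule finite_subset[OF _ finite_period_lattice_bounded[OF assms, of "2 * R"]])
         (auto simp: F_def L_def)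
    have bound: "norm (g x \<omega>) \<le> 10 * R * (1 / norm \<omega> ^ 3)" if "\<omega> \<in> L - F" "x \<in> cball 0 R" for x \<omega>
      unfolding g_def using that R by (intro wp_summand_bound) (auto simp: F_def)
    have summ: "(\<lambda>\<omega>. 10 * R * (1 / norm \<omega> ^ 3)) summable_on L - F"
      using summable_on_period_lattice[OF assms] unfolding L_def
      by (intro summable_on_cmult_right) (rule summable_on_subset, auto)
    have lim: "uniform_limit (cball 0 R) (\<lambda>X x. \<Sum>\<omega>\<in>X. g x \<omega>) (\<lambda>x. \<Sum>\<^sub>\<infinity>\<omega>\<in>L - F. g x \<omega>)
        (finite_subsets_at_top (L - F))"
      by (rule Weierstrass_m_test_general[OF bound summ])
    have "\<forall>\<^sub>F X in finite_subsets_at_top (L - F). (\<lambda>x. \<Sum>\<omega>\<in>X. g x \<omega>) holomorphic_on cball 0 R"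
    proof (rule eventually_finite_subsets_at_top_weakI)
      fix X assume "finite X" "X \<subseteq> L - F"
      hence "\<omega> \<noteq> 0 \<and> x \<noteq> \<omega>" if "\<omega> \<in> X" "x \<in> cball 0 R" for x \<omega>
        using that R by (force simp: F_def L_def)
      thus "(\<lambda>x. \<Sum>\<omega>\<in>X. g x \<omega>) holomorphic_on cball 0 R"
        unfolding g_def by (intro holomorphic_intros) auto
    qed
    hence ev: "\<forall>\<^sub>F X in finite_subsets_at_top (L - F).
        continuous_on (cball 0 R) (\<lambda>x. \<Sum>\<omega>\<in>X. g x \<omega>) \<and> (\<lambda>x. \<Sum>\<omega>\<in>X. g x \<omega>) holomorphic_on ball 0 R"
      by eventually_elim
         (auto intro: holomorphic_on_imp_continuous_on holomorphic_on_subset[OF _ ball_subset_cball])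
    have tail: "(\<lambda>x. \<Sum>\<^sub>\<infinity>\<omega>\<in>L - F. g x \<omega>) holomorphic_on ball 0 R"
      using holomorphic_uniform_limit[OF ev lim] by auto
    \<comment> \<open>This holds at lattice points too, since both sides use the same convention for
      division by 0.\<close>
    have eq: "wp \<omega>1 \<omega>3 x = 1 / x ^ 2 + ((\<Sum>\<omega>\<in>F. g x \<omega>) + (\<Sum>\<^sub>\<infinity>\<omega>\<in>L - F. g x \<omega>))"
      if x: "x \<in> ball 0 R" for x
    proof -
      have "(\<lambda>\<omega>. norm (g x \<omega>)) summable_on L - F"
        by (rule summable_on_comparison_test[OF summ]) (use bound x in auto)
      hence "g x summable_on L - F"
        by (rule abs_summable_summable)
      hence "infsum (g x) (F \<union> (L - F)) = (\<Sum>\<omega>\<in>F. g x \<omega>) + (\<Sum>\<^sub>\<infinity>\<omega>\<in>L - F. g x \<omega>)"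
        using fin by (subst infsum_Un_disjoint) auto
      moreover have "F \<union> (L - F) = L"
        by (auto simp: F_def)
      ultimately show ?thesis
        by (simp add: wp_def g_def L_def)
    qed
    have "(\<lambda>x. \<Sum>\<^sub>\<infinity>\<omega>\<in>L - F. g x \<omega>) meromorphic_on ball 0 R"
      using tail by (intro analytic_on_imp_meromorphic_on) (simp add: analytic_on_open)
    hence "(\<lambda>x. 1 / x ^ 2 + ((\<Sum>\<omega>\<in>F. g x \<omega>) + (\<Sum>\<^sub>\<infinity>\<omega>\<in>L - F. g x \<omega>))) meromorphic_on ball 0 R"
      unfolding g_def by (intro meromorphic_intros)
    hence "(\<lambda>x. 1 / x ^ 2 + ((\<Sum>\<omega>\<in>F. g x \<omega>) + (\<Sum>\<^sub>\<infinity>\<omega>\<in>L - F. g x \<omega>))) meromorphic_on {z}"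
      by (rule meromorphic_on_subset) (use R in auto)
    moreover have "\<forall>\<^sub>F x in at z. x \<in> ball 0 R"
      using R by (intro eventually_at_in_open') auto
    hence "\<forall>\<^sub>F x in at z. wp \<omega>1 \<omega>3 x =
        1 / x ^ 2 + ((\<Sum>\<omega>\<in>F. g x \<omega>) + (\<Sum>\<^sub>\<infinity>\<omega>\<in>L - F. g x \<omega>))"
      by eventually_elim (rule eq)
    ultimately show ?thesis
      by (subst meromorphic_on_cong) auto
  qed
  thus ?thesis
    by (subst meromorphic_on_meromorphic_at) blast
qed

lemma potential_meromorphic:
  assumes "\<omega>1 \<noteq> \<omega>3" "independent {\<omega>1, \<omega>3}"
  shows "potential \<omega>1 \<omega>3 l M \<delta> r s meromorphic_on UNIV"
proof -
  note [meromorphic_intros] =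
    wp_meromorphic[OF assms] meromorphic_on_compose[OF wp_meromorphic[OF assms, of UNIV]]
  show ?thesis
    unfolding potential_def by (intro meromorphic_intros analytic_intros) auto
qed

section \<open>The third-order equation and its first integral\<close>

lemma Xi_quantity_constant:
  assumes "v meromorphic_on UNIV" "\<Xi> meromorphic_on UNIV"
    and ode: "\<And>x. v analytic_on {x} \<Longrightarrow> \<Xi> analytic_on {x} \<Longrightarrow>
           (deriv ^^ 3) \<Xi> x - 4 * (v x - E) * deriv \<Xi> x - 2 * deriv v x * \<Xi> x = 0"
  obtains Q where "\<And>x. v analytic_on {x} \<Longrightarrow> \<Xi> analytic_on {x} \<Longrightarrow> Xi_quantity v E \<Xi> x = Q"
proof -
  define X where "X = {w. \<not> v analytic_on {w}} \<union> {w. \<not> \<Xi> analytic_on {w}}"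
  have X: "X sparse_in UNIV"
    unfolding X_def using assms(1,2)
    by (intro sparse_in_union' meromorphic_on_imp_sparse_singularities)
  have op: "open (UNIV - X)" and con: "connected (UNIV - X)"
    using X by (auto intro!: open_diff_sparse_pts sparse_imp_connected)
  have "(Xi_quantity v E \<Xi> has_field_derivative 0) (at x)" if "x \<in> UNIV - X" for x
  proof -
    have an: "v analytic_on {x}" "\<Xi> analytic_on {x}"
      using that by (auto simp: X_def)
    have d: "(v has_field_derivative deriv v x) (at x)"
      "(\<Xi> has_field_derivative deriv \<Xi> x) (at x)"
      "(deriv \<Xi> has_field_derivative (deriv ^^ 2) \<Xi> x) (at x)"
      "((deriv ^^ 2) \<Xi> has_field_derivative (deriv ^^ 3) \<Xi> x) (at x)"
      using an analytic_on_imp_differentiable_at analytic_deriv[OF an(2)] analytic_higher_deriv[OF an(2), of 2]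
      by (auto simp: DERIV_deriv_iff_field_differentiable numeral_2_eq_2 numeral_3_eq_3)
    show ?thesis
      unfolding Xi_quantity_def
      \<comment> \<open>The two terms \<open>\<Xi>' * \<Xi>'' / 2\<close> cancel, leaving
        \<open>\<Xi> / 2\<close> times the left-hand side of \<open>ode\<close>.\<close>
      by (rule derivative_eq_intros d refl)+ (use ode[OF an] in \<open>simp add: power2_eq_square\<close>, algebra)
  qed
  hence "Xi_quantity v E \<Xi> constant_on (UNIV - X)"
    using con op by (intro has_field_derivative_0_imp_constant_on) auto
  then obtain Q where "\<And>x. x \<in> UNIV - X \<Longrightarrow> Xi_quantity v E \<Xi> x = Q"
    by (auto simp: constant_on_def)
  thus ?thesis
    by (intro that) (auto simp: X_def)
qed

section \<open>The function \<open>\<Lambda>\<close> and its first two derivatives\<close>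

text \<open>The second derivative at \<open>x\<close> depends on the first one near
  \<open>x\<close>; hence \<open>f'\<close> is required on all of \<open>U\<close>, but
  \<open>f''\<close> only at the point.\<close>

lemma deriv2_eqI:
  assumes "open U" "x \<in> U" "\<And>y. y \<in> U \<Longrightarrow> (f has_field_derivative f' y) (at y)"
    and "(f' has_field_derivative f'') (at x)"
  shows "(deriv ^^ 2) f x = f''"
proof -
  have "deriv (deriv f) x = deriv f' x"
    by (rule deriv_cong_ev[OF _ refl])
       (use assms in \<open>auto simp: eventually_nhds intro!: exI[of _ U] DERIV_imp_deriv\<close>)
  thus ?thesis
    using assms(4) by (simp add: numeral_2_eq_2 DERIV_imp_deriv)
qed

text \<open>The second-order equation is stated as a first-order pair, a form that serves both the
  Schroedinger equation and the gauged one.\<close>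

lemma Lambda_branch_derivs:
  assumes U: "open U" "\<Xi> holomorphic_on U" "\<And>x. x \<in> U \<Longrightarrow> \<Xi> x \<noteq> 0"
    and Q: "\<And>x. x \<in> U \<Longrightarrow> Xi_quantity v E \<Xi> x = Q"
    and \<Lambda>: "Lambda_branch \<Xi> Q U \<Lambda>"
  obtains \<Lambda>' where "\<And>x. x \<in> U \<Longrightarrow> (\<Lambda> has_field_derivative \<Lambda>' x) (at x)"
    "\<And>x. x \<in> U \<Longrightarrow> (\<Lambda>' has_field_derivative (v x - E) * \<Lambda> x) (at x)"
proof -
  obtain S \<kappa> J where S: "S holomorphic_on U" "\<And>x. x \<in> U \<Longrightarrow> S x ^ 2 = \<Xi> x"
    and \<kappa>: "\<kappa> ^ 2 = - Q"
    and J: "\<And>x. x \<in> U \<Longrightarrow> (J has_field_derivative \<kappa> / \<Xi> x) (at x)"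
    and \<Lambda>_eq: "\<And>x. x \<in> U \<Longrightarrow> \<Lambda> x = S x * exp (J x)"
    using \<Lambda> unfolding Lambda_branch_def sqrt_branch_def by blast
  have d\<Xi>: "(\<Xi> has_field_derivative deriv \<Xi> x) (at x)"
    "(deriv \<Xi> has_field_derivative (deriv ^^ 2) \<Xi> x) (at x)"
    "(S has_field_derivative deriv S x) (at x)" if "x \<in> U" for x
    using U S that holomorphic_deriv[OF U(2,1)]
    by (auto simp: numeral_2_eq_2 intro: holomorphic_derivI)
  have S': "2 * S x * deriv S x = deriv \<Xi> x" if "x \<in> U" for x
  proof -
    have "((\<lambda>x. S x ^ 2) has_field_derivative 2 * S x * deriv S x) (at x)"
      by (auto intro!: derivative_eq_intros d\<Xi> that)
    hence "(\<Xi> has_field_derivative 2 * S x * deriv S x) (at x)"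
      using U(1) that by (rule has_field_derivative_transform_within_open) (auto simp: S)
    thus ?thesis
      using d\<Xi>(1)[OF that] DERIV_unique by blast
  qed
  \<comment> \<open>The logarithmic derivative adds \<open>S' / S = \<Xi>' / (2 * \<Xi>)\<close>,
    from differentiating \<open>S ^ 2 = \<Xi>\<close>, and
    \<open>J' = \<kappa> / \<Xi>\<close>.\<close>
  define \<Lambda>' where "\<Lambda>' = (\<lambda>x. (deriv \<Xi> x / 2 + \<kappa>) / \<Xi> x * \<Lambda> x)"
  have 1: "(\<Lambda> has_field_derivative \<Lambda>' x) (at x)" if x: "x \<in> U" for x
  proof -
    have nz: "S x \<noteq> 0"
      using S(2)[OF x] U(3)[OF x] by auto
    have "((\<lambda>x. S x * exp (J x)) has_field_derivative
        deriv S x * exp (J x) + S x * (exp (J x) * (\<kappa> / \<Xi> x))) (at x)"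
      by (auto intro!: derivative_eq_intros d\<Xi> J x)
    also have "deriv S x * exp (J x) + S x * (exp (J x) * (\<kappa> / \<Xi> x)) = \<Lambda>' x"
      using nz unfolding \<Lambda>'_def \<Lambda>_eq[OF x] S'[OF x, symmetric] S(2)[OF x, symmetric]
      by (simp add: field_simps power2_eq_square)
    finally show ?thesis
      using U(1) x by (rule has_field_derivative_transform_within_open) (auto simp: \<Lambda>_eq)
  qed
  have 2: "(\<Lambda>' has_field_derivative (v x - E) * \<Lambda> x) (at x)" if x: "x \<in> U" for x
  proof -
    have nz: "\<Xi> x \<noteq> 0"
      using U(3) x by blast
    let ?a = "\<Xi> x" and ?b = "deriv \<Xi> x" and ?c = "(deriv ^^ 2) \<Xi> x"
    have "?a ^ 2 * (E - v x) + 1 / 2 * ?a * ?c - 1 / 4 * ?b ^ 2 = - (\<kappa> ^ 2)"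
      using Q[OF x] \<kappa> by (simp add: Xi_quantity_def)
    \<comment> \<open>The left-hand side is the numerator of \<open>L' + L ^ 2\<close> for the
      logarithmic derivative \<open>L\<close> of \<open>\<Lambda>\<close>; its terms linear in
      \<open>\<kappa>\<close> cancel, so either root of \<open>- Q\<close> will do.\<close>
    hence *: "(?c / 2 * ?a - (?b / 2 + \<kappa>) * ?b) + (?b / 2 + \<kappa>) * (?b / 2 + \<kappa>) = (v x - E) * (?a * ?a)"
      by (simp add: power2_eq_square field_simps)
    have "((\<lambda>x. (deriv \<Xi> x / 2 + \<kappa>) / \<Xi> x * \<Lambda> x) has_field_derivative
        (?c / 2 * ?a - (?b / 2 + \<kappa>) * ?b) / (?a * ?a) * \<Lambda> x + \<Lambda>' x * ((?b / 2 + \<kappa>) / ?a)) (at x)"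
      by (rule DERIV_cong[OF DERIV_mult[OF DERIV_divide[OF
            DERIV_add[OF DERIV_cdivide[OF d\<Xi>(2)[OF x]] DERIV_const] d\<Xi>(1)[OF x] nz] 1[OF x]]]) simp
    hence "(\<Lambda>' has_field_derivative
        (?c / 2 * ?a - (?b / 2 + \<kappa>) * ?b) / (?a * ?a) * \<Lambda> x + \<Lambda>' x * ((?b / 2 + \<kappa>) / ?a)) (at x)"
      by (simp only: \<Lambda>'_def)
    also have "(?c / 2 * ?a - (?b / 2 + \<kappa>) * ?b) / (?a * ?a) * \<Lambda> x + \<Lambda>' x * ((?b / 2 + \<kappa>) / ?a)
        = ((?c / 2 * ?a - (?b / 2 + \<kappa>) * ?b) + (?b / 2 + \<kappa>) * (?b / 2 + \<kappa>)) / (?a * ?a) * \<Lambda> x"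
    proof -
      \<comment> \<open>Here \<open>X\<close> stands for the numerator from the quotient rule and
        \<open>Y\<close> for that of the logarithmic derivative.\<close>
      have "X / (a * a) * L + Y / a * L * (Y / a) = (X + Y * Y) / (a * a) * L" for X Y a L :: complex
        by (simp add: add_divide_distrib ring_distribs mult_ac)
      thus ?thesis
        unfolding \<Lambda>'_def .
    qed
    also have "\<dots> = (v x - E) * \<Lambda> x"
      unfolding * using nz by simp
    finally show ?thesis .
  qed
  from 1 2 show ?thesis
    by (rule that)
qed

section \<open>The gauge factor\<close>

text \<open>From \<open>G k ^ 2 = wp - b k\<close> follows \<open>wp' = 2 * G k * (G k)'\<close>, so
  the factor \<open>G k ^ r k\<close> has logarithmic derivative
  \<open>r k / 2 * wp' / (wp - b k)\<close>, the \<open>k\<close>-th term of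
  \<open>gauge_phi\<close>. Logarithmic derivatives only make sense off the zeros of
  \<open>\<Psi>\<close>; those are treated separately.\<close>

lemma Psi_g_branch_deriv:
  assumes U: "open U" "gauge_phi \<omega>1 \<omega>3 M \<delta> r holomorphic_on U"
    and r: "\<And>k. k \<in> {1..M} \<Longrightarrow> r k > 0"
    and \<Psi>: "Psi_g_branch \<omega>1 \<omega>3 M \<delta> r U \<Psi>" and x: "x \<in> U"
  shows "(\<Psi> has_field_derivative gauge_phi \<omega>1 \<omega>3 M \<delta> r x * \<Psi> x) (at x)"
proof -
  let ?w = "wp \<omega>1 \<omega>3" and ?\<phi> = "gauge_phi \<omega>1 \<omega>3 M \<delta> r"
  obtain G where G: "\<And>k. k \<in> {1..M} \<Longrightarrow> G k holomorphic_on U"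
      "\<And>k x. k \<in> {1..M} \<Longrightarrow> x \<in> U \<Longrightarrow> G k x ^ 2 = ?w x - ?w (\<delta> k)"
    and \<Psi>_eq: "\<And>x. x \<in> U \<Longrightarrow> \<Psi> x = (\<Prod>k\<in>{1..M}. G k x ^ r k)"
    using \<Psi> unfolding Psi_g_branch_def sqrt_branch_def by blast
  have "(\<lambda>x. \<Prod>k\<in>{1..M}. G k x ^ r k) holomorphic_on U"
    by (intro holomorphic_intros G)
  hence hol: "\<Psi> holomorphic_on U"
    by (rule holomorphic_transform) (simp add: \<Psi>_eq)
  have dG: "(G k has_field_derivative deriv (G k) y) (at y)" if "k \<in> {1..M}" "y \<in> U" for k y
    using G U(1) that holomorphic_derivI by blast
  have dw: "deriv ?w y = 2 * G k y * deriv (G k) y" if k: "k \<in> {1..M}" and y: "y \<in> U" for k y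
  proof -
    have "((\<lambda>y. G k y ^ 2 + ?w (\<delta> k)) has_field_derivative 2 * G k y * deriv (G k) y) (at y)"
      by (auto intro!: derivative_eq_intros dG k y)
    hence "(?w has_field_derivative 2 * G k y * deriv (G k) y) (at y)"
      using U(1) y by (rule has_field_derivative_transform_within_open) (simp add: G(2)[OF k])
    thus ?thesis
      by (rule DERIV_imp_deriv)
  qed
  have off: "deriv \<Psi> y = ?\<phi> y * \<Psi> y" if y: "y \<in> U" and nz: "\<Psi> y \<noteq> 0" for y
  proof -
    \<comment> \<open>Positivity of \<open>r k\<close> matters: with exponent 0 a zero of
      \<open>G k\<close> would go unnoticed in \<open>\<Psi>\<close>.\<close>
    have Gnz: "G k y \<noteq> 0" if "k \<in> {1..M}" for k
      using nz r[OF that] that unfolding \<Psi>_eq[OF y] by (force simp: prod_zero_iff)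
    have "((\<lambda>y. \<Prod>k\<in>{1..M}. G k y ^ r k) has_field_derivative
        (\<Prod>k\<in>{1..M}. G k y ^ r k) *
          (\<Sum>k\<in>{1..M}. (of_nat (r k) * (deriv (G k) y * G k y ^ (r k - 1))) / G k y ^ r k)) (at y)"
      by (rule has_field_derivative_prod') (auto intro!: derivative_eq_intros dG y simp: Gnz)
    also have "(\<Sum>k\<in>{1..M}. (of_nat (r k) * (deriv (G k) y * G k y ^ (r k - 1))) / G k y ^ r k) = ?\<phi> y"
      unfolding gauge_phi_def sum_distrib_left
    proof (rule sum.cong)
      fix k assume k: "k \<in> {1..M}"
      have "G k y ^ r k = G k y * G k y ^ (r k - 1)"
        using r[OF k] by (cases "r k") auto
      thus "of_nat (r k) * (deriv (G k) y * G k y ^ (r k - 1)) / G k y ^ r k =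
          1 / 2 * (of_nat (r k) * deriv ?w y / (?w y - ?w (\<delta> k)))"
        unfolding dw[OF k y] G(2)[OF k y, symmetric] using Gnz[OF k]
        by (simp add: power2_eq_square)
    qed simp
    finally have "(\<Psi> has_field_derivative (\<Prod>k\<in>{1..M}. G k y ^ r k) * ?\<phi> y) (at y)"
      using U(1) y by (rule has_field_derivative_transform_within_open) (simp add: \<Psi>_eq)
    thus ?thesis
      using y by (simp add: \<Psi>_eq DERIV_imp_deriv mult.commute)
  qed
  have "deriv \<Psi> x = ?\<phi> x * \<Psi> x"
  proof (cases "\<forall>\<^sub>F y in at x. \<Psi> y = 0")
    \<comment> \<open>By continuity \<open>\<Psi>\<close> vanishes at \<open>x\<close> as well,
      hence on a full neighbourhood, and both sides are 0.\<close>
    case True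
    have lim: "\<Psi> \<midarrow>x\<rightarrow> \<Psi> x"
      using hol U(1) x by (meson continuous_on_eq_continuous_at holomorphic_on_imp_continuous_on isContD)
    have "\<Psi> x = 0"
      using tendsto_cong[OF True] lim by (metis tendsto_const LIM_unique)
    hence "\<forall>\<^sub>F y in nhds x. \<Psi> y = 0"
      using True eventually_nhds_conv_at by metis
    hence "deriv \<Psi> x = deriv (\<lambda>_. 0) x"
      by (rule deriv_cong_ev) simp
    thus ?thesis
      using \<open>\<Psi> x = 0\<close> by simp
  next
    case False
    text \<open>The zeros of \<open>\<Psi>\<close> are then isolated, and the equation extends to them by continuity.\<close>
    have "\<Psi> analytic_on {x}"
      using hol U(1) x analytic_at by blast
    hence "\<forall>\<^sub>F y in at x. \<Psi> y \<noteq> 0"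
      using False not_essential_frequently_0_imp_eventually_0[of \<Psi> x]
      by (auto simp: frequently_def intro: isolated_singularity_at_analytic not_essential_analytic)
    moreover have "\<forall>\<^sub>F y in at x. y \<in> U"
      using U(1) x by (intro eventually_at_in_open')
    ultimately have ev: "\<forall>\<^sub>F y in at x. deriv \<Psi> y = ?\<phi> y * \<Psi> y"
      by eventually_elim (rule off)
    have "isCont (deriv \<Psi>) x" "isCont (\<lambda>y. ?\<phi> y * \<Psi> y) x"
      using hol U x by (auto intro!: continuous_on_interior[of U] holomorphic_on_imp_continuous_on
        holomorphic_intros simp: interior_open)
    thus ?thesis
      using tendsto_cong[OF ev] LIM_unique unfolding isCont_def by metis
  qed
  thus ?thesis
    using holomorphic_derivI[OF hol U(1) x] by simp
qed

text \<open>The gauged operator is \<open>(d/dx - \<phi>) ^ 2 - v + E\<close>. As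
  \<open>\<Psi>' = \<phi> * \<Psi>\<close>, applying \<open>d/dx - \<phi>\<close> to
  \<open>\<Psi> * \<Lambda>\<close> gives \<open>\<Psi> * \<Lambda>'\<close>, so the whole
  expression is \<open>\<Psi>\<close> times
  \<open>\<Lambda>'' - (v - E) * \<Lambda>\<close>.\<close>

lemma gauged_solutionI:
  assumes U: "open U" "\<phi> holomorphic_on U"
    and \<Psi>: "\<And>x. x \<in> U \<Longrightarrow> (\<Psi> has_field_derivative \<phi> x * \<Psi> x) (at x)"
    and \<Lambda>: "\<And>x. x \<in> U \<Longrightarrow> (\<Lambda> has_field_derivative \<Lambda>' x) (at x)"
      "\<And>x. x \<in> U \<Longrightarrow> (\<Lambda>' has_field_derivative (v x - E) * \<Lambda> x) (at x)"
  shows "gauged_solution \<phi> v E U (\<lambda>x. \<Psi> x * \<Lambda> x)"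
proof -
  \<comment> \<open>With \<open>\<Psi>\<close> factored out, the second differentiation again needs
    only \<open>\<Psi>' = \<phi> * \<Psi>\<close>.\<close>
  define f' where "f' = (\<lambda>x. \<Psi> x * (\<phi> x * \<Lambda> x + \<Lambda>' x))"
  have 1: "((\<lambda>x. \<Psi> x * \<Lambda> x) has_field_derivative f' x) (at x)" if "x \<in> U" for x
    unfolding f'_def by (rule derivative_eq_intros \<Psi> \<Lambda> that refl)+ (simp add: algebra_simps)
  have 2: "(f' has_field_derivative \<phi> x * \<Psi> x * (\<phi> x * \<Lambda> x + \<Lambda>' x)
      + \<Psi> x * (deriv \<phi> x * \<Lambda> x + \<phi> x * \<Lambda>' x + (v x - E) * \<Lambda> x)) (at x)" if "x \<in> U" for x
    unfolding f'_def
    by (rule derivative_eq_intros \<Psi> \<Lambda> that refl holomorphic_derivI[OF U(2,1) that])+ (simp add: algebra_simps)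
  show ?thesis
    unfolding gauged_solution_def
  proof safe
    show "(\<lambda>x. \<Psi> x * \<Lambda> x) holomorphic_on U"
      using 1 U(1) by (auto simp: holomorphic_on_open)
    fix x assume x: "x \<in> U"
    show "(deriv ^^ 2) (\<lambda>x. \<Psi> x * \<Lambda> x) x - 2 * \<phi> x * deriv (\<lambda>x. \<Psi> x * \<Lambda> x) x
        + (\<phi> x ^ 2 - deriv \<phi> x - v x + E) * (\<Psi> x * \<Lambda> x) = 0"
      unfolding deriv2_eqI[OF U(1) x 1 2[OF x], simplified] DERIV_imp_deriv[OF 1[OF x]] f'_def
      by (simp add: algebra_simps power2_eq_square)
  qed
qed

text \<open>The multivalued functions enter through their branches on open sets \<open>U\<close> on
  which \<open>v\<close> and \<open>\<Xi>\<close> are analytic and \<open>\<Xi>\<close> has no zero.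
  The constant \<open>Q\<close> is chosen before \<open>U\<close>, so one value serves all
  branches.\<close>

theorem proposition2p3:
  fixes \<omega>1 \<omega>3 E p c0 :: complex
    and M :: nat
    and l r :: "nat \<Rightarrow> nat"
    and \<delta> s oc :: "nat \<Rightarrow> complex"
    and bc dc :: "nat \<Rightarrow> nat \<Rightarrow> complex"
    and v \<Xi> :: "complex \<Rightarrow> complex"
  assumes "\<omega>1 \<noteq> \<omega>3" and "independent {\<omega>1, \<omega>3}"
    and "\<And>k. k \<in> {1..M} \<Longrightarrow> \<delta> k \<notin> period_lattice \<omega>1 \<omega>3"
    and "distinct (map (wp_e \<omega>1 \<omega>3) [1, 2, 3] @ map (\<lambda>k. wp \<omega>1 \<omega>3 (\<delta> k)) [1..<M + 1])"
    and "\<And>k. k \<in> {1..M} \<Longrightarrow> r k > 0"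
    and "fuchsian_constants \<omega>1 \<omega>3 l M \<delta> r s E p oc"
    and "\<And>k. k \<in> {1..M} \<Longrightarrow>
           apparent_singularity (fuchsian_P \<omega>1 \<omega>3 l M \<delta> r) (fuchsian_R \<omega>1 \<omega>3 l M \<delta> r p oc)
             (wp \<omega>1 \<omega>3 (\<delta> k))"
    and v: "v = potential \<omega>1 \<omega>3 l M \<delta> r s"
    and "doubly_periodic \<omega>1 \<omega>3 \<Xi>"
    and "\<And>x. \<Xi> (- x) = \<Xi> x"
    and "\<exists>x. \<Xi> x \<noteq> 0"
    and "\<And>x. v analytic_on {x} \<Longrightarrow> \<Xi> analytic_on {x} \<Longrightarrow>
           (deriv ^^ 3) \<Xi> x - 4 * (v x - E) * deriv \<Xi> x - 2 * deriv v x * \<Xi> x = 0"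
    and "\<And>x. (\<And>i. i \<in> {0..3} \<Longrightarrow> x + half_period \<omega>1 \<omega>3 i \<notin> period_lattice \<omega>1 \<omega>3) \<Longrightarrow>
           (\<And>k. k \<in> {1..M} \<Longrightarrow> wp \<omega>1 \<omega>3 x \<noteq> wp \<omega>1 \<omega>3 (\<delta> k)) \<Longrightarrow>
           \<Xi> x = c0
             + (\<Sum>i\<in>{0..3}. \<Sum>j<l i. bc i j * wp \<omega>1 \<omega>3 (x + half_period \<omega>1 \<omega>3 i) ^ (l i - j))
             + (\<Sum>k\<in>{1..M}. \<Sum>j<r k. dc k j / (wp \<omega>1 \<omega>3 x - wp \<omega>1 \<omega>3 (\<delta> k)) ^ (r k - j))"
  shows "\<exists>Q. (\<forall>x. v analytic_on {x} \<and> \<Xi> analytic_on {x} \<longrightarrow> Xi_quantity v E \<Xi> x = Q) \<and>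
           (\<forall>U \<Lambda>. open U \<and> v analytic_on U \<and> \<Xi> analytic_on U \<and> (\<forall>x\<in>U. \<Xi> x \<noteq> 0) \<and>
                   Lambda_branch \<Xi> Q U \<Lambda> \<longrightarrow>
              schroedinger_solution v E U \<Lambda> \<and>
              (\<forall>\<Psi>. gauge_phi \<omega>1 \<omega>3 M \<delta> r analytic_on U \<and> Psi_g_branch \<omega>1 \<omega>3 M \<delta> r U \<Psi> \<longrightarrow>
                 gauged_solution (gauge_phi \<omega>1 \<omega>3 M \<delta> r) v E U (\<lambda>x. \<Psi> x * \<Lambda> x)))"
proof -
  note nondeg = assms(1,2) and r_pos = assms(5) and periodic = assms(9) and ode = assms(12)
  have mero: "v meromorphic_on UNIV" "\<Xi> meromorphic_on UNIV"
    using potential_meromorphic[OF nondeg] periodic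
    by (auto simp: v doubly_periodic_def nicely_meromorphic_on_def)
  obtain Q where Q: "\<And>x. v analytic_on {x} \<Longrightarrow> \<Xi> analytic_on {x} \<Longrightarrow> Xi_quantity v E \<Xi> x = Q"
    using Xi_quantity_constant[OF mero ode] by blast
  show ?thesis
  proof (intro exI[of _ Q] conjI allI impI; (elim conjE)?)
    fix x assume "v analytic_on {x}" "\<Xi> analytic_on {x}"
    thus "Xi_quantity v E \<Xi> x = Q"
      by (rule Q)
  next
    fix U \<Lambda>
    assume U: "open U" "v analytic_on U" "\<Xi> analytic_on U" "\<forall>x\<in>U. \<Xi> x \<noteq> 0"
      and \<Lambda>: "Lambda_branch \<Xi> Q U \<Lambda>"
    have "Xi_quantity v E \<Xi> x = Q" if "x \<in> U" for x
      using U that by (intro Q) (auto intro: analytic_on_subset)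
    then obtain \<Lambda>' where \<Lambda>': "\<And>x. x \<in> U \<Longrightarrow> (\<Lambda> has_field_derivative \<Lambda>' x) (at x)"
      "\<And>x. x \<in> U \<Longrightarrow> (\<Lambda>' has_field_derivative (v x - E) * \<Lambda> x) (at x)"
      using Lambda_branch_derivs[OF U(1) _ _ _ \<Lambda>] U analytic_imp_holomorphic by metis
    show "schroedinger_solution v E U \<Lambda>"
      unfolding schroedinger_solution_def schroedinger_at_def
      using \<Lambda>' U(1) deriv2_eqI[OF U(1) _ \<Lambda>'(1) \<Lambda>'(2)]
      by (auto simp: holomorphic_on_open algebra_simps)
    fix \<Psi>
    assume \<phi>: "gauge_phi \<omega>1 \<omega>3 M \<delta> r analytic_on U" and \<Psi>: "Psi_g_branch \<omega>1 \<omega>3 M \<delta> r U \<Psi>"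
    have hol: "gauge_phi \<omega>1 \<omega>3 M \<delta> r holomorphic_on U"
      using \<phi> by (rule analytic_imp_holomorphic)
    show "gauged_solution (gauge_phi \<omega>1 \<omega>3 M \<delta> r) v E U (\<lambda>x. \<Psi> x * \<Lambda> x)"
      using U(1) hol Psi_g_branch_deriv[OF U(1) hol r_pos \<Psi>] \<Lambda>' by (rule gauged_solutionI)
  qed
qed

end
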